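(* Let $a<b$ be real numbers, let $f:[a,b]\to\mathbb{R}$ be continuous, let $m_0$ be a real number with $\min\{f(a),f(b)\}\le m_0\le \max_{x\in[a,b]}f(x)$, and let $u_0$ be an upper bound for $f$ on $[a,b]$. Let $[m_0,u_0],[m_1,u_1],\dots,[m_n,u_n],\dots$ be the intervals generated by the value-bisection algorithm for $f$ started from $(m_0,u_0)$. Then the limits $\lim_{n\to\infty}u_n$ and $\lim_{n\to\infty}m_n$ exist, are equal, and their common value is the maximum value of $f$ on $[a,b]$. Moreover, if $c_n=\frac{m_n+u_n}{2}$ and $M=\lim_{n\to\infty}c_n$, then for every $n\ge 0$ $$|M-c_n|\le 2^{-(n+1)}(u_0-m_0).$$
   Context: The value-bisection algorithm for a continuous function $f:[a,b]\to\mathbb{R}$ started from $(m_0,u_0)$, where $\min\{f(a),f(b)\}\le m_0\le\max_{[a,b]}f$ and $f(x)\le u_0$ for all $x\in[a,b]$, is defined recursively as follows. Given $m_n,u_n$, put $c_n=\frac{m_n+u_n}{2}$. If the equation $f(x)=c_n$ has a solution $x\in[a,b]$, set $m_{n+1}=c_n$ and $u_{n+1}=u_n$; if it has no solution in $[a,b]$, set $m_{n+1}=m_n$ and $u_{n+1}=c_n$. The process is continued for all $n\ge 0$ (no stopping criterion). *)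

theory Defs
  imports "HOL-Analysis.Analysis"
begin

text \<open>
  The choice operator \<open>GREATEST\<close> is meaningful only when the maximum is attained; the lemma
  \<open>max_on_interval\<close> below shows that this is so for every continuous function on a nonempty
  compact interval.
\<close>

definition max_on :: "(real \<Rightarrow> real) \<Rightarrow> real set \<Rightarrow> real" where
  "max_on f S = (GREATEST y. y \<in> f ` S)"

lemma max_on_interval:
  fixes f :: "real \<Rightarrow> real"
  assumes "a \<le> b" and "continuous_on {a..b} f"
  shows "max_on f {a..b} \<in> f ` {a..b}"
    and "\<And>x. x \<in> {a..b} \<Longrightarrow> f x \<le> max_on f {a..b}"
proof -
  obtain z where z: "z \<in> {a..b}" "\<forall>x\<in>{a..b}. f x \<le> f z"
    using continuous_attains_sup[of "{a..b}" f] assms by auto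
  have "max_on f {a..b} = f z"
    unfolding max_on_def by (rule Greatest_equality) (use z in auto)
  then show "max_on f {a..b} \<in> f ` {a..b}"
    and "\<And>x. x \<in> {a..b} \<Longrightarrow> f x \<le> max_on f {a..b}"
    using z by auto
qed

text \<open>The state of the algorithm after \<open>n\<close> steps is the pair \<open>(m\<^sub>n, u\<^sub>n)\<close>.\<close>

definition bisection_step :: "(real \<Rightarrow> real) \<Rightarrow> real \<Rightarrow> real \<Rightarrow> real \<times> real \<Rightarrow> real \<times> real" where
  "bisection_step f a b = (\<lambda>(m, u).
     let c = (m + u) / 2 in
     if \<exists>x\<in>{a..b}. f x = c then (c, u) else (m, c))"

primrec bisection ::
  "(real \<Rightarrow> real) \<Rightarrow> real \<Rightarrow> real \<Rightarrow> real \<Rightarrow> real \<Rightarrow> nat \<Rightarrow> real \<times> real" where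
  "bisection f a b m0 u0 0 = (m0, u0)"
| "bisection f a b m0 u0 (Suc n) = bisection_step f a b (bisection f a b m0 u0 n)"

end

(* The maximum M of f always lies in [m n, u n], and each step halves this interval. For the first
   claim: f takes every value between min (f a) (f b) and M by the intermediate value theorem, so a
   midpoint that is not attained must exceed M, while an attained one is at most M. *)
theory Submission
  imports Defs
begin

text \<open>This turns the test of the algorithm into a comparison with the maximum. The lower bound
  on \<open>y\<close> excludes values below the range of \<open>f\<close>, for which the
  right-to-left implication fails.\<close>

lemma attained_iff_le_max_on:
  fixes f :: "real \<Rightarrow> real"
  assumes "a \<le> b" and cont: "continuous_on {a..b} f" and "min (f a) (f b) \<le> y"
  shows "(\<exists>x\<in>{a..b}. f x = y) \<longleftrightarrow> y \<le> max_on f {a..b}"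
proof
  assume "\<exists>x\<in>{a..b}. f x = y"
  then show "y \<le> max_on f {a..b}"
    using max_on_interval(2)[OF assms(1,2)] by auto
next
  assume "y \<le> max_on f {a..b}"
  \<comment> \<open>Intermediate value theorem: a connected image contains everything between two of
    its points, here an endpoint value and the maximum.\<close>
  moreover have "connected (f ` {a..b})"
    using cont by (intro connected_continuous_image) auto
  moreover have "max_on f {a..b} \<in> f ` {a..b}"
    using max_on_interval(1)[OF assms(1,2)] .
  moreover have "min (f a) (f b) \<in> f ` {a..b}"
    using \<open>a \<le> b\<close> by (auto simp: min_def)
  ultimately have "y \<in> f ` {a..b}"
    using \<open>min (f a) (f b) \<le> y\<close> connectedD_interval by blast
  then show "\<exists>x\<in>{a..b}. f x = y"
    by auto
qed

text \<open>The bound by \<open>min (f a) (f b)\<close> is carried along so that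
  \<open>attained_iff_le_max_on\<close> applies to every midpoint.\<close>

lemma bisection_invariant:
  assumes "a \<le> b" and "continuous_on {a..b} f"
    and "min (f a) (f b) \<le> m0" and "m0 \<le> max_on f {a..b}" and "max_on f {a..b} \<le> u0"
    and "bisection f a b m0 u0 n = (m, u)"
  shows "min (f a) (f b) \<le> m \<and> m \<le> max_on f {a..b} \<and> max_on f {a..b} \<le> u
    \<and> u - m = (u0 - m0) / 2 ^ n"
  using assms(6)
proof (induction n arbitrary: m u)
  case 0
  then show ?case using assms by auto
next
  case (Suc n)
  obtain m' u' where step: "bisection f a b m0 u0 n = (m', u')"
    by fastforce
  define c where "c = (m' + u') / 2"
  note IH = Suc.IH[OF step]
  then have "m' \<le> c"
    by (auto simp: c_def)
  with IH have att: "(\<exists>x\<in>{a..b}. f x = c) \<longleftrightarrow> c \<le> max_on f {a..b}"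
    by (intro attained_iff_le_max_on assms(1,2)) auto
  \<comment> \<open>With the test replaced by \<open>att\<close>, both branches keep the maximum
    between the new bounds, and only arithmetic remains.\<close>
  have mu: "(m, u) = (if c \<le> max_on f {a..b} then (c, u') else (m', c))"
    using Suc.prems
    unfolding bisection.simps step bisection_step_def prod.case Let_def c_def [symmetric] att
    by (rule sym)
  then have "u - m = (u' - m') / 2"
    by (auto simp: c_def field_simps split: if_splits)
  with IH have "u - m = (u0 - m0) / 2 ^ Suc n"
    by simp
  with mu IH \<open>m' \<le> c\<close> show ?case
    by (auto split: if_splits)
qed

theorem proposition3p1:
  fixes f :: "real \<Rightarrow> real" and a b m0 u0 :: real and m u c :: "nat \<Rightarrow> real"
  assumes "a < b"
    and "continuous_on {a..b} f"
    and "min (f a) (f b) \<le> m0"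
    and "m0 \<le> max_on f {a..b}"
    and "\<forall>x\<in>{a..b}. f x \<le> u0"
    and "\<And>n. m n = fst (bisection f a b m0 u0 n)"
    and "\<And>n. u n = snd (bisection f a b m0 u0 n)"
    and "\<And>n. c n = (m n + u n) / 2"
  shows "u \<longlonglongrightarrow> max_on f {a..b}
    \<and> m \<longlonglongrightarrow> max_on f {a..b}
    \<and> convergent c
    \<and> (\<forall>n. \<bar>lim c - c n\<bar> \<le> (u0 - m0) / 2 ^ (n + 1))"
proof -
  define M where "M = max_on f {a..b}"
  \<comment> \<open>\<open>M\<close> is itself a value of \<open>f\<close>, so the upper bound
    \<open>u0\<close> applies to it.\<close>
  have "M \<le> u0"
    using max_on_interval(1)[of a b f] assms unfolding M_def by auto
  then have inv: "m n \<le> M" "M \<le> u n" "u n - m n = (u0 - m0) / 2 ^ n" for n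
    using bisection_invariant[of a b f m0 u0 n "m n" "u n"] assms unfolding M_def by auto
  have width: "(\<lambda>n. (u0 - m0) / 2 ^ n) \<longlonglongrightarrow> 0"
    using LIMSEQ_divide_realpow_zero[of 2 "u0 - m0"] by simp
  \<comment> \<open>\<open>m n\<close> is squeezed between \<open>M\<close> minus the width and
    \<open>M\<close>; the limit of \<open>u\<close> then follows by adding the width, which tends to
    0.\<close>
  have m: "m \<longlonglongrightarrow> M"
  proof (rule tendsto_sandwich)
    show "(\<lambda>n. M - (u0 - m0) / 2 ^ n) \<longlonglongrightarrow> M"
      using tendsto_diff[OF tendsto_const width, of M] by simp
    show "\<forall>\<^sub>F n in sequentially. M - (u0 - m0) / 2 ^ n \<le> m n"
    proof (intro always_eventually allI)
      show "M - (u0 - m0) / 2 ^ n \<le> m n" for n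
        using inv(2,3)[of n] by linarith
    qed
  qed (use inv in auto)
  have "(\<lambda>n. m n + (u0 - m0) / 2 ^ n) \<longlonglongrightarrow> M"
    using tendsto_add[OF m width] by simp
  moreover have "m n + (u0 - m0) / 2 ^ n = u n" for n
    using inv(3)[of n] by simp
  ultimately have u: "u \<longlonglongrightarrow> M"
    by simp
  have "(\<lambda>n. (m n + u n) / 2) \<longlonglongrightarrow> (M + M) / 2"
    by (intro tendsto_intros m u) simp
  moreover have "c = (\<lambda>n. (m n + u n) / 2)"
    using assms(8) by (rule ext)
  ultimately have c: "c \<longlonglongrightarrow> M"
    by simp
  have "\<bar>M - c n\<bar> \<le> (u0 - m0) / 2 ^ (n + 1)" for n
  proof -
    \<comment> \<open>A point of an interval is at most half its length away from the midpoint; this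
      half raises the exponent from \<open>n\<close> to \<open>n + 1\<close>.\<close>
    have "\<bar>M - c n\<bar> \<le> (u n - m n) / 2"
      unfolding assms(8) using inv(1,2)[of n] by (simp add: abs_le_iff field_simps)
    then show ?thesis
      by (simp add: inv(3))
  qed
  with m u c show ?thesis
    unfolding M_def by (auto simp: convergent_def limI)
qed

end
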